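(* Let $n\ge1$, let $\Sigma_1,\ldots,\Sigma_n$ be finite sets, let $f\colon\Sigma_1\times\cdots\times\Sigma_n\to\{0,1\}$, let $S\subseteq\{1,\ldots,n\}$ and let $H\ge1$ be an integer. Denote $r=\mathrm{rk}^{(H)}(f)$ and let $|A|=|\Sigma_1|+\cdots+|\Sigma_n|$ be the number of assignments for $f$. Then $$C^{r+1,A}(f^S)\le 2Hr\cdot\lceil\log_2|A|\rceil\quad\text{and}\quad C^{r+1,B}(f^S)\le 2Hr\cdot\lceil\log_2|A|\rceil.$$
   Context: **$H$-head rank.** An assignment is a pair $(i,\sigma)$ with $i\in\{1,\ldots,n\}$, $\sigma\in\Sigma_i$; $A$ is the set of all assignments. The assignment $(i,\sigma)$ is consistent with $\bar w=(\sigma_1,\ldots,\sigma_n)$ iff $\sigma_i=\sigma$. For a bijection $\tau\colon\{1,\ldots,|A|\}\to A$, the a-query $q_\tau\colon\Sigma_1\times\cdots\times\Sigma_n\to A$ is defined by $q_\tau(\bar w)=\tau(j)$ for the minimal $j$ such that $\tau(j)$ is consistent with $\bar w$. An $H$-degree a-query is a product $\bar w\mapsto(q_{\tau_1}(\bar w),\ldots,q_{\tau_H}(\bar w))$ of $H$ a-queries. A decision tree over $H$-degree a-queries is a rooted tree in which each non-leaf node $v$ is labeled by an $H$-degree a-query $q_v$ and has exactly $|\mathrm{Im}(q_v)|$ outgoing edges, labeled by the distinct elements of $\mathrm{Im}(q_v)$, and each leaf is labeled by an output value; on input $\bar w$ one descends from the root, at each $v$ following the edge labeled $q_v(\bar w)$,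 and outputs the label of the leaf reached. $\mathrm{rk}^{(H)}(f)$ is the minimal depth (maximal number of edges on a root-to-leaf path) of such a tree that outputs $f(\bar w)$ on every $\bar w$. **Communication protocols.** Let $g\colon\mathcal X\times\mathcal Y\to\mathcal Z$ with finite sets $\mathcal X,\mathcal Y,\mathcal Z$. A $k$-round Alice-first protocol is given by $k$ positive integers $\ell_1,\ldots,\ell_k$ (message lengths); functions $M_i\colon\{0,1\}^{\ell_1+\cdots+\ell_{i-1}}\times\mathcal X\to\{0,1\}^{\ell_i}$ for odd $i\in\{1,\ldots,k\}$ and $M_i\colon\{0,1\}^{\ell_1+\cdots+\ell_{i-1}}\times\mathcal Y\to\{0,1\}^{\ell_i}$ for even $i\in\{1,\ldots,k\}$; and an output function $out\colon\{0,1\}^{\ell_1+\cdots+\ell_k}\to\mathcal Z$. On input $(x,y)$ one sets $m_i=M_i(m_1\ldots m_{i-1},x)$ for odd $i$ and $m_i=M_i(m_1\ldots m_{i-1},y)$ for even $i$, and the output is $out(m_1\ldots m_k)$. Its communication complexity is $\ell_1+\cdots+\ell_k$. The protocol computes $g$ if the output on every $(x,y)$ is $g(x,y)$. $C^{k,A}(g)$ is the minimal communication complexity of a $k$-round Alice-first protocol computing $g$. Bob-first protocols and $C^{k,B}(g)$ are defined by reversing the roles of Alice and Bob (Bob, who knows $y$, sends the odd-numbered messages, Alice the even-numbered ones). **The function $f^S$.** $f^S\colon\bigl(\prod_{i\in S}\Sigma_i\bigr)\times\bigl(\prod_{i\in\{1,\ldots,n\}\setminus S}\Sigma_i\bigr)\to\{0,1\}$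 maps the pair consisting of the letters of $\bar w$ at positions in $S$ (Alice's input) and the letters at positions outside $S$ (Bob's input) to $f(\bar w)$.
   Formalization: The formal statement assumes r ≥ 1, i.e. that f is not constant; for r = 0 the claimed bound is 0, while a 1-round protocol has a message of positive length and so costs at least 1 bit, so the claim fails in every such case. *)

theory Defs
  imports Complex_Main "HOL-Library.FuncSet" "HOL-Library.Extended_Nat"
begin

section \<open>Assignments and a-queries\<close>

text \<open>Words over \<open>\<Sigma> 1, ..., \<Sigma> n\<close> are extensional functions on \<open>{1..n}\<close>. The alphabets are arbitrary
  subsets of one type, hence may differ, overlap or be empty.\<close>

definition words :: "nat \<Rightarrow> (nat \<Rightarrow> 'a set) \<Rightarrow> (nat \<Rightarrow> 'a) set" where
  "words n \<Sigma> = PiE {1..n} \<Sigma>"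

definition assignments :: "nat \<Rightarrow> (nat \<Rightarrow> 'a set) \<Rightarrow> (nat \<times> 'a) set" where
  "assignments n \<Sigma> = Sigma {1..n} \<Sigma>"

lemma card_assignments:
  assumes "\<And>i. i \<in> {1..n} \<Longrightarrow> finite (\<Sigma> i)"
  shows "card (assignments n \<Sigma>) = (\<Sum>i=1..n. card (\<Sigma> i))"
  unfolding assignments_def using assms by (intro card_SigmaI) auto

definition consistent :: "nat \<times> 'a \<Rightarrow> (nat \<Rightarrow> 'a) \<Rightarrow> bool" where
  "consistent a w \<longleftrightarrow> w (fst a) = snd a"

definition ordering :: "nat \<Rightarrow> (nat \<Rightarrow> 'a set) \<Rightarrow> (nat \<Rightarrow> nat \<times> 'a) \<Rightarrow> bool" where
  "ordering n \<Sigma> \<tau> \<longleftrightarrow> bij_betw \<tau> {1..card (assignments n \<Sigma>)} (assignments n \<Sigma>)"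

definition a_query ::
  "nat \<Rightarrow> (nat \<Rightarrow> 'a set) \<Rightarrow> (nat \<Rightarrow> nat \<times> 'a) \<Rightarrow> (nat \<Rightarrow> 'a) \<Rightarrow> nat \<times> 'a" where
  "a_query n \<Sigma> \<tau> w =
     \<tau> (LEAST j. j \<in> {1..card (assignments n \<Sigma>)} \<and> consistent (\<tau> j) w)"

text \<open>Tuples in \<open>A\<^sup>H\<close> are lists of length \<open>H\<close>.\<close>

definition is_degree_query ::
  "nat \<Rightarrow> nat \<Rightarrow> (nat \<Rightarrow> 'a set) \<Rightarrow> ((nat \<Rightarrow> 'a) \<Rightarrow> (nat \<times> 'a) list) \<Rightarrow> bool" where
  "is_degree_query H n \<Sigma> q \<longleftrightarrow>
     (\<exists>\<tau>s. length \<tau>s = H \<and> (\<forall>\<tau>\<in>set \<tau>s. ordering n \<Sigma> \<tau>) \<and>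
        (\<forall>w\<in>words n \<Sigma>. q w = map (\<lambda>\<tau>. a_query n \<Sigma> \<tau> w) \<tau>s))"

section \<open>Decision trees and rank\<close>

text \<open>A non-leaf carries a query \<open>q\<close> and a partial map \<open>ch\<close> from edge labels to subtrees: there is
  an outgoing edge labelled \<open>b\<close> iff \<open>b \<in> dom ch\<close>.\<close>

datatype ('w, 'b, 'z) dtree =
    Leaf 'z
  | Node "'w \<Rightarrow> 'b" "'b \<rightharpoonup> ('w, 'b, 'z) dtree"

primrec dtree_output :: "('w, 'b, 'z) dtree \<Rightarrow> 'w \<Rightarrow> 'z" where
  "dtree_output (Leaf z) = (\<lambda>w. z)"
| "dtree_output (Node q ch) = (\<lambda>w. the ((map_option dtree_output \<circ> ch) (q w)) w)"

text \<open>Since \<open>ran (map_option dtree_depth \<circ> ch) = dtree_depth ` ran ch\<close>, the depth of a non-leaf is the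
  maximum of \<open>Suc (dtree_depth t)\<close> over its subtrees \<open>t\<close>; the extra \<open>0\<close> matters only for a node
  without children, which occurs only if there are no words at all.\<close>

primrec dtree_depth :: "('w, 'b, 'z) dtree \<Rightarrow> nat" where
  "dtree_depth (Leaf z) = 0"
| "dtree_depth (Node q ch) = Max (insert 0 (Suc ` ran (map_option dtree_depth \<circ> ch)))"

inductive query_tree ::
  "nat \<Rightarrow> nat \<Rightarrow> (nat \<Rightarrow> 'a set) \<Rightarrow> (nat \<Rightarrow> 'a, (nat \<times> 'a) list, 'z) dtree \<Rightarrow> bool"
  for H :: nat and n :: nat and \<Sigma> :: "nat \<Rightarrow> 'a set" where
  "query_tree H n \<Sigma> (Leaf z)"
| "is_degree_query H n \<Sigma> q \<Longrightarrow> dom ch = q ` words n \<Sigma> \<Longrightarrow>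
   (\<And>b t. ch b = Some t \<Longrightarrow> query_tree H n \<Sigma> t) \<Longrightarrow> query_tree H n \<Sigma> (Node q ch)"

definition dtree_computes ::
  "nat \<Rightarrow> (nat \<Rightarrow> 'a set) \<Rightarrow> ((nat \<Rightarrow> 'a) \<Rightarrow> 'z) \<Rightarrow> (nat \<Rightarrow> 'a, 'b, 'z) dtree \<Rightarrow> bool" where
  "dtree_computes n \<Sigma> f t \<longleftrightarrow> (\<forall>w\<in>words n \<Sigma>. dtree_output t w = f w)"

text \<open>For finite alphabets and \<open>H \<ge> 1\<close> a tree as required always exists, so the minimum is attained: an ordering
  that lists the assignments \<open>(i, \<sigma>)\<close> of a fixed position \<open>i\<close> first reveals the letter at \<open>i\<close>, so
  \<open>n\<close> levels of queries suffice.\<close>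

definition rk :: "nat \<Rightarrow> nat \<Rightarrow> (nat \<Rightarrow> 'a set) \<Rightarrow> ((nat \<Rightarrow> 'a) \<Rightarrow> 'z) \<Rightarrow> nat" where
  "rk H n \<Sigma> f =
     (LEAST d. \<exists>t. query_tree H n \<Sigma> t \<and> dtree_computes n \<Sigma> f t \<and> dtree_depth t = d)"

section \<open>Communication protocols\<close>

text \<open>Rounds are numbered from \<open>1\<close>. In an Alice-first protocol only the values of \<open>msg_odd\<close> at odd
  rounds (sent by Alice) and of \<open>msg_even\<close> at even rounds (sent by Bob) are used.\<close>

record ('x, 'y, 'z) protocol =
  msg_len :: "nat \<Rightarrow> nat"
  msg_odd :: "nat \<Rightarrow> bool list \<Rightarrow> 'x \<Rightarrow> bool list"
  msg_even :: "nat \<Rightarrow> bool list \<Rightarrow> 'y \<Rightarrow> bool list"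
  out :: "bool list \<Rightarrow> 'z"

definition valid_protocol :: "nat \<Rightarrow> 'x set \<Rightarrow> 'y set \<Rightarrow> ('x, 'y, 'z) protocol \<Rightarrow> bool" where
  "valid_protocol k X Y P \<longleftrightarrow>
     (\<forall>i\<in>{1..k}. msg_len P i > 0 \<and>
        (\<forall>m. length m = (\<Sum>j=1..<i. msg_len P j) \<longrightarrow>
           (odd i \<longrightarrow> (\<forall>x\<in>X. length (msg_odd P i m x) = msg_len P i)) \<and>
           (even i \<longrightarrow> (\<forall>y\<in>Y. length (msg_even P i m y) = msg_len P i))))"

text \<open>\<open>transcript P x y i\<close> is the concatenation of the first \<open>i\<close> messages.\<close>

primrec transcript :: "('x, 'y, 'z) protocol \<Rightarrow> 'x \<Rightarrow> 'y \<Rightarrow> nat \<Rightarrow> bool list" where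
  "transcript P x y 0 = []"
| "transcript P x y (Suc i) = transcript P x y i @
     (if odd (Suc i) then msg_odd P (Suc i) (transcript P x y i) x
      else msg_even P (Suc i) (transcript P x y i) y)"

definition protocol_computes ::
  "nat \<Rightarrow> 'x set \<Rightarrow> 'y set \<Rightarrow> ('x \<Rightarrow> 'y \<Rightarrow> 'z) \<Rightarrow> ('x, 'y, 'z) protocol \<Rightarrow> bool" where
  "protocol_computes k X Y g P \<longleftrightarrow> (\<forall>x\<in>X. \<forall>y\<in>Y. out P (transcript P x y k) = g x y)"

definition protocol_cost :: "nat \<Rightarrow> ('x, 'y, 'z) protocol \<Rightarrow> nat" where
  "protocol_cost k P = (\<Sum>i=1..k. msg_len P i)"

text \<open>The complexity is \<open>\<infinity>\<close> if no \<open>k\<close>-round protocol computes \<open>g\<close> (e.g. for \<open>k = 1\<close> and \<open>g\<close> depending on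
  the input of the silent party); hence the extended naturals.\<close>

definition comm_Alice :: "nat \<Rightarrow> 'x set \<Rightarrow> 'y set \<Rightarrow> ('x \<Rightarrow> 'y \<Rightarrow> 'z) \<Rightarrow> enat" where
  "comm_Alice k X Y g =
     Inf {enat (protocol_cost k P) | P :: ('x, 'y, 'z) protocol.
            valid_protocol k X Y P \<and> protocol_computes k X Y g P}"

definition comm_Bob :: "nat \<Rightarrow> 'x set \<Rightarrow> 'y set \<Rightarrow> ('x \<Rightarrow> 'y \<Rightarrow> 'z) \<Rightarrow> enat" where
  "comm_Bob k X Y g = comm_Alice k Y X (\<lambda>y x. g x y)"

text \<open>Messages are nonempty, so \<open>k\<close> rounds cost at least \<open>k\<close> bits, even for a constant function. In
  particular a bound of the form \<open>c * rk H n \<Sigma> f\<close> on the \<open>(rk H n \<Sigma> f + 1)\<close>-round complexity fails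
  when the rank is \<open>0\<close>.\<close>

lemma rounds_le_comm_Alice: "enat k \<le> comm_Alice k X Y g"
proof -
  have "k \<le> protocol_cost k P" if "valid_protocol k X Y P" for P :: "('a, 'b, 'c) protocol"
  proof -
    have "(\<Sum>i=1..k. 1) \<le> protocol_cost k P"
      unfolding protocol_cost_def
      using that by (intro sum_mono) (auto simp: valid_protocol_def Suc_le_eq)
    then show ?thesis by simp
  qed
  then show ?thesis
    unfolding comm_Alice_def by (intro Inf_greatest) auto
qed

lemma rounds_le_comm_Bob: "enat k \<le> comm_Bob k X Y g"
  unfolding comm_Bob_def by (rule rounds_le_comm_Alice)

section \<open>Splitting a function between the players\<close>

definition alice_inputs :: "(nat \<Rightarrow> 'a set) \<Rightarrow> nat set \<Rightarrow> (nat \<Rightarrow> 'a) set" where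
  "alice_inputs \<Sigma> S = PiE S \<Sigma>"

definition bob_inputs :: "nat \<Rightarrow> (nat \<Rightarrow> 'a set) \<Rightarrow> nat set \<Rightarrow> (nat \<Rightarrow> 'a) set" where
  "bob_inputs n \<Sigma> S = PiE ({1..n} - S) \<Sigma>"

text \<open>For \<open>S \<subseteq> {1..n}\<close> and \<open>x\<close>, \<open>y\<close> in the two input sets, the combined function is again
  extensional on \<open>{1..n}\<close>, i.e. a word.\<close>

definition split_fun :: "((nat \<Rightarrow> 'a) \<Rightarrow> 'z) \<Rightarrow> nat set \<Rightarrow> (nat \<Rightarrow> 'a) \<Rightarrow> (nat \<Rightarrow> 'a) \<Rightarrow> 'z" where
  "split_fun f S x y = f (\<lambda>i. if i \<in> S then x i else y i)"

end

theory Submission imports Defs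
begin

text \<open>A player who sees only the letters at the positions in \<open>T\<close> can determine, for an ordering \<open>\<tau>\<close>, the
  first index of \<open>\<tau>\<close> carrying an assignment that is consistent with those letters; the answer of the a-query is
  the assignment at the smaller of the indices of the two players. An \<open>H\<close>-degree a-query thus costs
  \<open>H \<lceil>log\<^sub>2 |A|\<rceil>\<close> bits from each player. The player who completes the answer to one query knows
  the next node of the tree and appends to the same message the own part of the answer to the next query, so that
  \<open>r\<close> queries take \<open>r + 1\<close> rounds.\<close>

section \<open>Pipelined simulation of answer exchanges\<close>

text \<open>Chunks \<open>2 * k\<close> and \<open>2 * k + 1\<close> of a transcript are the answers to query \<open>k\<close>. The player who speaks first
  answers first exactly for even \<open>k\<close>.\<close>

primrec decode_state ::
  "('s \<Rightarrow> bool list \<Rightarrow> bool list \<Rightarrow> 's) \<Rightarrow> 's \<Rightarrow> nat \<Rightarrow> nat \<Rightarrow> bool list \<Rightarrow> 's" where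
  "decode_state nxt s0 m 0 tr = s0"
| "decode_state nxt s0 m (Suc k) tr =
     (let s = decode_state nxt s0 m k tr;
          u = take m (drop (2 * m * k) tr);
          v = take m (drop (2 * m * k + m) tr)
      in if even k then nxt s u v else nxt s v u)"

text \<open>With queries numbered from 0, round \<open>i\<close> completes query
  \<open>i - 2\<close> and opens query \<open>i - 1\<close>; round 1 has nothing to complete, round
  \<open>r + 1\<close> nothing to open. The state for query \<open>i - 1\<close> depends on the
  answer just being sent, hence the decoding of \<open>tr @ own\<close>.\<close>

definition pipelined_message ::
  "('s \<Rightarrow> bool list \<Rightarrow> bool list \<Rightarrow> 's) \<Rightarrow> 's \<Rightarrow> nat \<Rightarrow> nat \<Rightarrow> ('s \<Rightarrow> 'x \<Rightarrow> bool list) \<Rightarrow>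
     nat \<Rightarrow> bool list \<Rightarrow> 'x \<Rightarrow> bool list" where
  "pipelined_message nxt s0 m r p i tr x =
     (let own = (if i = 1 then [] else p (decode_state nxt s0 m (i - 2) tr) x)
      in own @ (if i \<le> r then p (decode_state nxt s0 m (i - 1) (tr @ own)) x else []))"

lemma length_pipelined_message:
  assumes "\<And>s. length (p s x) = m"
  shows "length (pipelined_message nxt s0 m r p i tr x) =
           (if i = 1 then 0 else m) + (if i \<le> r then m else 0)"
  by (simp add: pipelined_message_def Let_def assms)

text \<open>States and transitions are abstract so that swapping the arguments of \<open>nxt\<close>
  also yields the Bob-first bound. Answers have length \<open>m\<close> in every state, so message
  lengths do not depend on the inputs.\<close>

lemma comm_Alice_le_of_answers:
  fixes pa :: "'s \<Rightarrow> 'x \<Rightarrow> bool list" and pb :: "'s \<Rightarrow> 'y \<Rightarrow> bool list"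
    and nxt :: "'s \<Rightarrow> bool list \<Rightarrow> bool list \<Rightarrow> 's"
  assumes m: "m > 0" and r: "r \<ge> 1"
    and la: "\<And>s x. x \<in> X \<Longrightarrow> length (pa s x) = m"
    and lb: "\<And>s y. y \<in> Y \<Longrightarrow> length (pb s y) = m"
    and result: "\<And>x y. x \<in> X \<Longrightarrow> y \<in> Y \<Longrightarrow>
      res (((\<lambda>s. nxt s (pa s x) (pb s y)) ^^ r) s0) = g x y"
  shows "comm_Alice (r + 1) X Y g \<le> enat (2 * m * r)"
proof -
  \<comment> \<open>The first and the last message carry one answer each, all others two;
    \<open>r \<ge> 1\<close> makes these two rounds distinct and both messages nonempty.\<close>
  define len where "len i = (if i = 1 then 0 else m) + (if i \<le> r then m else 0)" for i :: nat
  define P where "P = \<lparr>msg_len = len,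
    msg_odd = pipelined_message nxt s0 m r pa, msg_even = pipelined_message nxt s0 m r pb,
    out = (\<lambda>tr. res (decode_state nxt s0 m r tr))\<rparr>"
  have "valid_protocol (r + 1) X Y P"
    using m r by (auto simp: valid_protocol_def P_def len_def length_pipelined_message la lb)
  moreover have "protocol_computes (r + 1) X Y g P"
    unfolding protocol_computes_def
  proof (intro ballI)
    fix x y assume x: "x \<in> X" and y: "y \<in> Y"
    define run where "run k = ((\<lambda>s. nxt s (pa s x) (pb s y)) ^^ k) s0" for k
    define fst_ans where "fst_ans k = (if even k then pa (run k) x else pb (run k) y)" for k
    define snd_ans where "snd_ans k = (if even k then pb (run k) y else pa (run k) x)" for k
    define full where "full k = concat (map (\<lambda>k. fst_ans k @ snd_ans k) [0..<k])" for k
    have full_0: "full 0 = []"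
      and full_Suc: "full (Suc k) = full k @ fst_ans k @ snd_ans k" for k
      by (simp_all add: full_def)
    have len_fst: "length (fst_ans k) = m" and len_snd: "length (snd_ans k) = m" for k
      using la[OF x] lb[OF y] by (simp_all add: fst_ans_def snd_ans_def)
    have len_full: "length (full k) = 2 * m * k" for k
      by (induction k) (simp_all add: full_0 full_Suc len_fst len_snd)
    \<comment> \<open>The suffix \<open>z\<close> is arbitrary because senders decode transcripts
      that already run past \<open>full k\<close>; only the first \<open>2 * m * k\<close> bits are
      read.\<close>
    have decode: "decode_state nxt s0 m k (full k @ z) = run k" for k z
    proof (induction k arbitrary: z)
      case 0
      show ?case by (simp add: run_def)
    next
      case (Suc k)
      show ?case
        using Suc[of "fst_ans k @ snd_ans k @ z"]
        by (simp add: full_Suc len_full len_fst len_snd Let_def)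
          (simp add: run_def fst_ans_def snd_ans_def)
    qed
    have decode': "decode_state nxt s0 m k (full k) = run k" for k
      using decode[of k "[]"] by simp
    \<comment> \<open>The transcript runs half a query ahead of \<open>full i\<close>. By parity
      \<open>snd_ans i\<close> and \<open>fst_ans (Suc i)\<close> come from the same player, the
      sender of round \<open>i + 2\<close>, so one message holds both.\<close>
    have step: "transcript P x y (Suc (Suc i)) =
        full (Suc i) @ (if Suc i < r then fst_ans (Suc i) else [])"
      if tr: "transcript P x y (Suc i) = full i @ fst_ans i" and i: "i < r" for i
    proof -
      note d1 = decode[of i "fst_ans i"]
      have d2: "decode_state nxt s0 m (Suc i) (full i @ fst_ans i @ snd_ans i) = run (Suc i)"
        using decode'[of "Suc i"] by (simp only: full_Suc)
      show ?thesis
      proof (cases "even i")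
        case True
        then have "pb (run i) y = snd_ans i" "pb (run (Suc i)) y = fst_ans (Suc i)"
          by (simp_all add: fst_ans_def snd_ans_def)
        with True i show ?thesis
          unfolding transcript.simps(2)[of P x y "Suc i"] tr
          by (simp add: P_def pipelined_message_def Let_def d1 d2 full_Suc Suc_le_eq
              del: decode_state.simps)
      next
        case False
        then have "pa (run i) x = snd_ans i" "pa (run (Suc i)) x = fst_ans (Suc i)"
          by (simp_all add: fst_ans_def snd_ans_def)
        with False i show ?thesis
          unfolding transcript.simps(2)[of P x y "Suc i"] tr
          by (simp add: P_def pipelined_message_def Let_def d1 d2 full_Suc Suc_le_eq
              del: decode_state.simps)
      qed
    qed
    have tr: "transcript P x y (Suc i) = full i @ fst_ans i" if "i < r" for i
      using that
    proof (induction i)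
      case 0
      then show ?case
        by (simp add: P_def pipelined_message_def full_0 fst_ans_def run_def)
    next
      case (Suc i)
      then show ?case using step[of i] by simp
    qed
    obtain r' where r': "r = Suc r'" using r by (cases r) auto
    have "transcript P x y (Suc r) = full r"
      using step[OF tr, of r'] r' by simp
    then show "out P (transcript P x y (r + 1)) = g x y"
      using result[OF x y] decode'[of r]
      by (simp add: P_def run_def del: transcript.simps)
  qed
  moreover have "protocol_cost (r + 1) P = 2 * m * r"
  proof -
    have "protocol_cost (r + 1) P = len 1 + (\<Sum>i=Suc 1..r. len i) + len (r + 1)"
      using r by (simp add: protocol_cost_def P_def sum.atLeast_Suc_atMost)
    also have "(\<Sum>i=Suc 1..r. len i) = (\<Sum>i=Suc 1..r. 2 * m)"
      by (intro sum.cong) (auto simp: len_def)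
    also have "len 1 + \<dots> + len (r + 1) = 2 * m * r"
      using r by (cases r) (simp_all add: len_def)
    finally show ?thesis .
  qed
  ultimately show ?thesis
    unfolding comm_Alice_def by (intro Inf_lower) (auto intro!: exI[of _ P])
qed

section \<open>Answering a query by two players\<close>

text \<open>The last index serves as the answer of a player to whom no assignment is consistent (for instance if
  \<open>T = {}\<close>); it never decreases the minimum.\<close>

definition part_index ::
  "nat \<Rightarrow> (nat \<Rightarrow> 'a set) \<Rightarrow> nat set \<Rightarrow> (nat \<Rightarrow> nat \<times> 'a) \<Rightarrow> (nat \<Rightarrow> 'a) \<Rightarrow> nat" where
  "part_index n \<Sigma> T \<tau> x =
     (let N = card (assignments n \<Sigma>)
      in LEAST j. j \<in> {1..N} \<and> (j = N \<or> fst (\<tau> j) \<in> T \<and> consistent (\<tau> j) x))"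

lemma finite_assignments:
  "\<forall>i\<in>{1..n}. finite (\<Sigma> i) \<Longrightarrow> finite (assignments n \<Sigma>)"
  by (auto simp: assignments_def)

lemma finite_words: "\<forall>i\<in>{1..n}. finite (\<Sigma> i) \<Longrightarrow> finite (words n \<Sigma>)"
  by (auto simp: words_def intro!: finite_PiE)

lemma part_index_props:
  assumes "card (assignments n \<Sigma>) \<ge> 1"
  defines "N \<equiv> card (assignments n \<Sigma>)"
  shows "part_index n \<Sigma> T \<tau> x \<in> {1..N}"
    and "part_index n \<Sigma> T \<tau> x = N \<or>
      fst (\<tau> (part_index n \<Sigma> T \<tau> x)) \<in> T \<and> consistent (\<tau> (part_index n \<Sigma> T \<tau> x)) x"
    and "j \<in> {1..N} \<Longrightarrow> fst (\<tau> j) \<in> T \<Longrightarrow> consistent (\<tau> j) x \<Longrightarrow> part_index n \<Sigma> T \<tau> x \<le> j"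
proof -
  let ?P = "\<lambda>j. j \<in> {1..N} \<and> (j = N \<or> fst (\<tau> j) \<in> T \<and> consistent (\<tau> j) x)"
  have eq: "part_index n \<Sigma> T \<tau> x = (LEAST j. ?P j)"
    by (simp add: part_index_def N_def Let_def)
  have "?P N" using assms by auto
  then have P: "?P (part_index n \<Sigma> T \<tau> x)" unfolding eq by (rule LeastI)
  show "part_index n \<Sigma> T \<tau> x \<in> {1..N}"
    and "part_index n \<Sigma> T \<tau> x = N \<or>
      fst (\<tau> (part_index n \<Sigma> T \<tau> x)) \<in> T \<and> consistent (\<tau> (part_index n \<Sigma> T \<tau> x)) x"
    using P by auto
  show "j \<in> {1..N} \<Longrightarrow> fst (\<tau> j) \<in> T \<Longrightarrow> consistent (\<tau> j) x \<Longrightarrow> part_index n \<Sigma> T \<tau> x \<le> j"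
    unfolding eq by (rule Least_le) auto
qed

lemma ordering_consistent_ex:
  assumes "n \<ge> 1" "w \<in> words n \<Sigma>" "ordering n \<Sigma> \<tau>"
  shows "\<exists>j\<in>{1..card (assignments n \<Sigma>)}. consistent (\<tau> j) w"
proof -
  have "(1, w 1) \<in> assignments n \<Sigma>"
    using assms by (auto simp: assignments_def words_def)
  then obtain j where "j \<in> {1..card (assignments n \<Sigma>)}" "\<tau> j = (1, w 1)"
    using assms(3) unfolding ordering_def bij_betw_def by (metis imageE)
  then show ?thesis by (intro bexI[of _ j]) (simp_all add: consistent_def)
qed

text \<open>Each position belongs to exactly one player, and consistency at that position can be
  checked by its owner alone. The owner of the first consistent assignment therefore names its
  index, and the other player names no smaller one.\<close>

lemma a_query_split:
  assumes n: "n \<ge> 1" and S: "S \<subseteq> {1..n}" and \<tau>: "ordering n \<Sigma> \<tau>"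
    and w: "w \<in> words n \<Sigma>" and w_def: "w = (\<lambda>i. if i \<in> S then x i else y i)"
  shows "a_query n \<Sigma> \<tau> w =
    \<tau> (min (part_index n \<Sigma> S \<tau> x) (part_index n \<Sigma> ({1..n} - S) \<tau> y))"
proof -
  define N where "N = card (assignments n \<Sigma>)"
  let ?i = "part_index n \<Sigma> S \<tau> x" and ?j = "part_index n \<Sigma> ({1..n} - S) \<tau> y"
  let ?Q = "\<lambda>j. j \<in> {1..N} \<and> consistent (\<tau> j) w"
  define J where "J = (LEAST j. ?Q j)"
  have ex: "\<exists>j. ?Q j" using ordering_consistent_ex[OF n w \<tau>] by (auto simp: N_def)
  have J: "?Q J" unfolding J_def by (rule LeastI_ex) (rule ex)
  have J_le: "J \<le> j" if "?Q j" for j unfolding J_def using that by (rule Least_le)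
  have N: "card (assignments n \<Sigma>) \<ge> 1" using J by (auto simp: N_def)
  note pi = part_index_props[OF N, folded N_def]
  have con: "consistent (\<tau> j) w \<longleftrightarrow>
      fst (\<tau> j) \<in> S \<and> consistent (\<tau> j) x \<or> fst (\<tau> j) \<in> {1..n} - S \<and> consistent (\<tau> j) y"
    if "j \<in> {1..N}" for j
  proof -
    have "\<tau> j \<in> assignments n \<Sigma>"
      using \<tau> that unfolding ordering_def N_def by (rule bij_betwE[THEN bspec])
    then have "fst (\<tau> j) \<in> {1..n}" by (auto simp: assignments_def)
    then show ?thesis by (auto simp: consistent_def w_def)
  qed
  \<comment> \<open>A part index is either the fallback \<open>N\<close>, which is at least
    \<open>J\<close>, or an index consistent with \<open>w\<close>, to which minimality of
    \<open>J\<close> applies.\<close>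
  have "J \<le> ?i" "J \<le> ?j"
    using J J_le con pi(1,2) by (metis atLeastAtMost_iff)+
  moreover have "?i \<le> J \<or> ?j \<le> J"
    using J con pi(3) by blast
  ultimately have "min ?i ?j = J" by linarith
  then show ?thesis by (simp add: a_query_def J_def N_def)
qed

section \<open>Decision trees attaining the rank\<close>

text \<open>A word is consistent with exactly one assignment at position \<open>i\<close>; listing
  that block first forces the least consistent index into it.\<close>

lemma ex_ordering_position_first:
  assumes fin: "\<forall>i\<in>{1..n}. finite (\<Sigma> i)" and i: "i \<in> {1..n}"
  obtains \<tau> where "ordering n \<Sigma> \<tau>"
    and "\<And>w. w \<in> words n \<Sigma> \<Longrightarrow> a_query n \<Sigma> \<tau> w = (i, w i)"
proof -
  let ?A = "assignments n \<Sigma>" and ?B = "{i} \<times> \<Sigma> i"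
  have finA: "finite ?A" using fin by (rule finite_assignments)
  have sub: "?B \<subseteq> ?A" using i by (auto simp: assignments_def)
  have finB: "finite ?B" using finA sub finite_subset by blast
  have le: "card ?B \<le> card ?A" using finA sub by (rule card_mono)
  obtain g where g: "bij_betw g {1..card ?B} ?B"
    using finite_same_card_bij[of "{1..card ?B}" ?B] finB by auto
  obtain h where h: "bij_betw h {Suc (card ?B)..card ?A} (?A - ?B)"
    using finite_same_card_bij[of "{Suc (card ?B)..card ?A}" "?A - ?B"] finA finB sub
    by (auto simp: card_Diff_subset)
  define \<tau> where "\<tau> j = (if j \<in> {1..card ?B} then g j else h j)" for j
  have "bij_betw \<tau> ({1..card ?B} \<union> {Suc (card ?B)..card ?A}) (?B \<union> (?A - ?B))"
    unfolding \<tau>_def by (rule bij_betw_disjoint_Un[OF g h]) auto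
  moreover have "{1..card ?B} \<union> {Suc (card ?B)..card ?A} = {1..card ?A}"
    using le by auto
  moreover have "?B \<union> (?A - ?B) = ?A" using sub by blast
  ultimately have ord: "ordering n \<Sigma> \<tau>" by (simp add: ordering_def)
  have "a_query n \<Sigma> \<tau> w = (i, w i)" if w: "w \<in> words n \<Sigma>" for w
  proof -
    let ?Q = "\<lambda>j. j \<in> {1..card ?A} \<and> consistent (\<tau> j) w"
    have "w i \<in> \<Sigma> i" using w i by (auto simp: words_def)
    then have "(i, w i) \<in> g ` {1..card ?B}" unfolding bij_betw_imp_surj_on[OF g] by simp
    then obtain k where "(i, w i) = g k" and k: "k \<in> {1..card ?B}" by (rule imageE)
    then have "\<tau> k = (i, w i)" by (simp add: \<tau>_def)
    with k le have "?Q k" by (auto simp: consistent_def)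
    then have Q: "?Q (LEAST j. ?Q j)" and "(LEAST j. ?Q j) \<le> k"
      by (rule LeastI, rule Least_le)
    then have "(LEAST j. ?Q j) \<in> {1..card ?B}" using k by auto
    then have "\<tau> (LEAST j. ?Q j) = g (LEAST j. ?Q j)" by (simp only: \<tau>_def if_True)
    also have "\<dots> \<in> ?B" by (rule bij_betwE[OF g, THEN bspec]) fact
    finally have "\<tau> (LEAST j. ?Q j) \<in> ?B" .
    then show ?thesis
      using Q by (auto simp: a_query_def consistent_def prod_eq_iff)
  qed
  with ord show ?thesis by (rule that)
qed

text \<open>Induction on the number \<open>k\<close> of unread positions. The letters read so far
  are recorded in \<open>p\<close>, which is generalized because each edge out of the root records
  another letter.\<close>

lemma ex_query_tree_known_suffix:
  assumes fin: "\<forall>i\<in>{1..n}. finite (\<Sigma> i)" and H: "H \<ge> 1" and k: "k \<le> n"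
  shows "\<exists>t. query_tree H n \<Sigma> t \<and>
    (\<forall>w\<in>words n \<Sigma>. (\<forall>i\<in>{Suc k..n}. w i = p i) \<longrightarrow> dtree_output t w = f w)"
  using k
proof (induction k arbitrary: p)
  case 0
  have "w = restrict p {1..n}" if "w \<in> words n \<Sigma>" "\<forall>i\<in>{Suc 0..n}. w i = p i" for w
    using that by (auto simp: words_def PiE_def extensional_def restrict_def)
  then show ?case
    by (intro exI[of _ "Leaf (f (restrict p {1..n}))"])
      (auto intro: query_tree.intros)
next
  case (Suc k)
  then have "Suc k \<in> {1..n}" by simp
  from ex_ordering_position_first[OF fin this] obtain \<tau> where \<tau>: "ordering n \<Sigma> \<tau>"
    and \<tau>_eq: "\<And>w. w \<in> words n \<Sigma> \<Longrightarrow> a_query n \<Sigma> \<tau> w = (Suc k, w (Suc k))"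
    by blast
  define q where "q w = replicate H (a_query n \<Sigma> \<tau> w)" for w
  have "\<exists>T. \<forall>a. query_tree H n \<Sigma> (T a) \<and>
    (\<forall>w\<in>words n \<Sigma>. (\<forall>i\<in>{Suc k..n}. w i = (p(Suc k := a)) i) \<longrightarrow> dtree_output (T a) w = f w)"
    by (rule choice) (use Suc in auto)
  then obtain T where T: "\<And>a. query_tree H n \<Sigma> (T a)"
    and T_out: "\<And>a w. w \<in> words n \<Sigma> \<Longrightarrow> \<forall>i\<in>{Suc k..n}. w i = (p(Suc k := a)) i \<Longrightarrow>
      dtree_output (T a) w = f w"
    by blast
  \<comment> \<open>All \<open>H\<close> entries of a label are the same pair of position and
    letter, so its head, which exists by \<open>H \<ge> 1\<close>, selects the subtree.\<close>
  define ch where "ch b = (if b \<in> q ` words n \<Sigma> then Some (T (snd (hd b))) else None)" for b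
  have "is_degree_query H n \<Sigma> q"
    unfolding is_degree_query_def using \<tau>
    by (intro exI[of _ "replicate H \<tau>"]) (auto simp: q_def)
  then have "query_tree H n \<Sigma> (Node q ch)"
    by (rule query_tree.intros)
      (auto simp: ch_def T split: if_splits)
  moreover have "dtree_output (Node q ch) w = f w"
    if w: "w \<in> words n \<Sigma>" and agree: "\<forall>i\<in>{Suc (Suc k)..n}. w i = p i" for w
  proof -
    have "ch (q w) = Some (T (w (Suc k)))"
      using w H by (auto simp: ch_def q_def \<tau>_eq hd_replicate)
    moreover have "dtree_output (T (w (Suc k))) w = f w"
      using agree by (intro T_out[OF w]) auto
    ultimately show ?thesis by simp
  qed
  ultimately show ?case by blast
qed

text \<open>The \<open>LEAST\<close> in \<open>rk\<close> speaks about a tree only once some tree is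
  known to compute \<open>f\<close>.\<close>

lemma rk_attained:
  assumes "\<forall>i\<in>{1..n}. finite (\<Sigma> i)" and "H \<ge> 1"
  obtains t where "query_tree H n \<Sigma> t" "dtree_computes n \<Sigma> f t" "dtree_depth t = rk H n \<Sigma> f"
proof -
  have "\<exists>d t. query_tree H n \<Sigma> t \<and> dtree_computes n \<Sigma> f t \<and> dtree_depth t = d"
    \<comment> \<open>For \<open>k = n\<close> no position has been read, so any \<open>p\<close>
      will do.\<close>
    using ex_query_tree_known_suffix[OF assms order_refl, of undefined f]
    by (auto simp: dtree_computes_def)
  then have "\<exists>t. query_tree H n \<Sigma> t \<and> dtree_computes n \<Sigma> f t \<and> dtree_depth t = rk H n \<Sigma> f"
    unfolding rk_def by (rule LeastI_ex)
  then show ?thesis using that by blast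
qed

text \<open>This makes the logarithm positive and hence the messages nonempty. Positive rank
  excludes a single leaf, so there are two distinct words, and a position where they differ supplies
  two assignments.\<close>

lemma card_assignments_ge_2:
  assumes fin: "\<forall>i\<in>{1..n}. finite (\<Sigma> i)" and rk: "rk H n \<Sigma> f \<ge> 1"
  shows "card (assignments n \<Sigma>) \<ge> 2"
proof -
  have "\<exists>w\<in>words n \<Sigma>. \<exists>w'\<in>words n \<Sigma>. w \<noteq> w'"
  proof (rule ccontr)
    assume "\<not> ?thesis"
    then have "\<exists>z. \<forall>w\<in>words n \<Sigma>. f w = z" by metis
    then obtain z where "dtree_computes n \<Sigma> f (Leaf z :: (nat \<Rightarrow> 'a, (nat \<times> 'a) list, _) dtree)"
      unfolding dtree_computes_def by fastforce
    then have "rk H n \<Sigma> f \<le> 0"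
      unfolding rk_def by (intro Least_le exI[of _ "Leaf z"]) (auto intro: query_tree.intros)
    with rk show False by simp
  qed
  then obtain w w' where w: "w \<in> words n \<Sigma>" "w' \<in> words n \<Sigma>" "w \<noteq> w'" by blast
  then obtain i where i: "i \<in> {1..n}" "w i \<noteq> w' i"
    unfolding words_def by (metis PiE_ext)
  have "card {(i, w i), (i, w' i)} \<le> card (assignments n \<Sigma>)"
    using w i finite_assignments[OF fin]
    by (intro card_mono) (auto simp: assignments_def words_def)
  then show ?thesis using i by simp
qed

section \<open>Playing a decision tree\<close>

text \<open>Leaves are fixed points, so a short path can be padded to exactly \<open>r\<close>
  steps.\<close>

definition tree_step :: "'w \<Rightarrow> ('w, 'b, 'z) dtree \<Rightarrow> ('w, 'b, 'z) dtree" where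
  "tree_step w t = (case t of Leaf z \<Rightarrow> Leaf z | Node q ch \<Rightarrow> the (ch (q w)))"

lemma Suc_dtree_depth_child_le:
  assumes "finite (dom ch)" and t': "ch b = Some t'"
  shows "Suc (dtree_depth t') \<le> dtree_depth (Node q ch)"
proof -
  have "finite (ran (map_option dtree_depth \<circ> ch))"
    using assms(1) by (intro finite_ran) (simp add: dom_def)
  moreover have "dtree_depth t' \<in> ran (map_option dtree_depth \<circ> ch)"
    using t' by (auto simp: ran_def)
  ultimately show ?thesis by (auto intro!: Max_ge)
qed

text \<open>Agreement of \<open>stp\<close> with \<open>tree_step w\<close> is assumed on query
  trees only: \<open>stp\<close> will be the joint update of the players, which is known to follow
  the tree only there.\<close>

lemma tree_step_iterate:
  assumes fin: "\<forall>i\<in>{1..n}. finite (\<Sigma> i)" and w: "w \<in> words n \<Sigma>"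
    and step: "\<And>t. query_tree H n \<Sigma> t \<Longrightarrow> stp t = tree_step w t"
  shows "query_tree H n \<Sigma> t \<Longrightarrow> dtree_depth t \<le> d \<Longrightarrow> (stp ^^ d) t = Leaf (dtree_output t w)"
proof (induction d arbitrary: t)
  case 0
  then show ?case
  proof cases
    \<comment> \<open>Depth 0 rules out an inner node: the edge labelled \<open>q w\<close> leads to
      a child, so the depth would be at least 1.\<close>
    case (2 q ch)
    then obtain t' where t': "ch (q w) = Some t'" using w by blast
    have "finite (dom ch)" using 2 finite_words[OF fin] by simp
    then have "Suc (dtree_depth t') \<le> dtree_depth t"
      using 2 t' by (simp only: Suc_dtree_depth_child_le)
    with 0 show ?thesis by simp
  qed simp
next
  case (Suc d)
  have unfold: "(stp ^^ Suc d) t = (stp ^^ d) (tree_step w t)"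
    using step[OF Suc.prems(1)] by (simp add: funpow_swap1)
  from Suc.prems(1) show ?case
  proof cases
    case (1 z)
    then show ?thesis using unfold Suc.IH[OF Suc.prems(1)] by (simp add: tree_step_def)
  next
    case (2 q ch)
    then obtain t' where t': "ch (q w) = Some t'" using w by blast
    have "finite (dom ch)" using 2 finite_words[OF fin] by simp
    then have "Suc (dtree_depth t') \<le> dtree_depth t"
      using 2 t' by (simp only: Suc_dtree_depth_child_le)
    then have "(stp ^^ d) t' = Leaf (dtree_output t' w)"
      using 2 t' Suc.prems(2) by (intro Suc.IH) auto
    then show ?thesis using unfold t' 2 by (simp add: tree_step_def)
  qed
qed

text \<open>A query is given only as a function; fixing one representing list in advance lets both
  players refer to the same orderings.\<close>

definition query_orderings ::
  "nat \<Rightarrow> nat \<Rightarrow> (nat \<Rightarrow> 'a set) \<Rightarrow> ((nat \<Rightarrow> 'a) \<Rightarrow> (nat \<times> 'a) list) \<Rightarrow> (nat \<Rightarrow> nat \<times> 'a) list" where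
  "query_orderings H n \<Sigma> q = (SOME \<tau>s. length \<tau>s = H \<and> (\<forall>\<tau>\<in>set \<tau>s. ordering n \<Sigma> \<tau>) \<and>
     (\<forall>w\<in>words n \<Sigma>. q w = map (\<lambda>\<tau>. a_query n \<Sigma> \<tau> w) \<tau>s))"

lemma query_orderings:
  assumes "is_degree_query H n \<Sigma> q"
  shows "length (query_orderings H n \<Sigma> q) = H"
    and "\<tau> \<in> set (query_orderings H n \<Sigma> q) \<Longrightarrow> ordering n \<Sigma> \<tau>"
    and "w \<in> words n \<Sigma> \<Longrightarrow> q w = map (\<lambda>\<tau>. a_query n \<Sigma> \<tau> w) (query_orderings H n \<Sigma> q)"
  using someI_ex[OF assms[unfolded is_degree_query_def], folded query_orderings_def] by auto

text \<open>Indices rather than assignments are exchanged, since their minimum decides the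
  answer.\<close>

definition part_answer ::
  "nat \<Rightarrow> nat \<Rightarrow> (nat \<Rightarrow> 'a set) \<Rightarrow> nat set \<Rightarrow>
     (nat \<Rightarrow> 'a, (nat \<times> 'a) list, 'z) dtree \<Rightarrow> (nat \<Rightarrow> 'a) \<Rightarrow> nat list" where
  "part_answer H n \<Sigma> T t x = (case t of Leaf z \<Rightarrow> []
     | Node q ch \<Rightarrow> map (\<lambda>\<tau>. part_index n \<Sigma> T \<tau> x) (query_orderings H n \<Sigma> q))"

definition next_node ::
  "nat \<Rightarrow> nat \<Rightarrow> (nat \<Rightarrow> 'a set) \<Rightarrow>
     (nat \<Rightarrow> 'a, (nat \<times> 'a) list, 'z) dtree \<Rightarrow> nat list \<Rightarrow> nat list \<Rightarrow>
     (nat \<Rightarrow> 'a, (nat \<times> 'a) list, 'z) dtree" where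
  "next_node H n \<Sigma> t is js = (case t of Leaf z \<Rightarrow> Leaf z
     | Node q ch \<Rightarrow> the (ch (map2 (\<lambda>\<tau> j. \<tau> j) (query_orderings H n \<Sigma> q) (map2 min is js))))"

lemma next_node_eq_tree_step:
  assumes n: "n \<ge> 1" and S: "S \<subseteq> {1..n}" and t: "query_tree H n \<Sigma> t"
    and w: "w \<in> words n \<Sigma>" and w_def: "w = (\<lambda>i. if i \<in> S then x i else y i)"
  shows "next_node H n \<Sigma> t (part_answer H n \<Sigma> S t x) (part_answer H n \<Sigma> ({1..n} - S) t y) =
    tree_step w t"
  using t
proof cases
  case (1 z)
  then show ?thesis by (simp add: next_node_def tree_step_def)
next
  case (2 q ch)
  note ords = query_orderings[OF 2(2)]
  have "q w = map (\<lambda>\<tau>. \<tau> (min (part_index n \<Sigma> S \<tau> x) (part_index n \<Sigma> ({1..n} - S) \<tau> y)))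
      (query_orderings H n \<Sigma> q)"
    unfolding ords(3)[OF w]
    by (intro map_cong refl a_query_split[OF n S ords(2) w w_def])
  moreover have "map2 (\<lambda>\<tau> j. \<tau> j) \<tau>s (map2 min (map u \<tau>s) (map v \<tau>s)) =
      map (\<lambda>\<tau>. \<tau> (min (u \<tau>) (v \<tau>))) \<tau>s"
    for u v :: "(nat \<Rightarrow> nat \<times> 'a) \<Rightarrow> nat" and \<tau>s
    by (induction \<tau>s) auto
  ultimately show ?thesis
    using 2 by (simp add: next_node_def tree_step_def part_answer_def)
qed

section \<open>Binary encoding of answers and assembly of the protocols\<close>

lemma ex_encoding:
  assumes "N \<le> 2 ^ L"
  shows "\<exists>enc :: nat list \<Rightarrow> bool list. (\<forall>js. length (enc js) = H * L) \<and>
    inj_on enc {js. set js \<subseteq> {1..N} \<and> length js = H}"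
proof -
  let ?J = "{js. set js \<subseteq> {1..N} \<and> length js = H}"
  let ?B = "{bs :: bool list. set bs \<subseteq> UNIV \<and> length bs = H * L}"
  have fin: "finite ?J" "finite ?B" by (rule finite_lists_length_eq, simp)+
  have "card ?J = N ^ H" using card_lists_length_eq[of "{1..N}" H] by simp
  also have "\<dots> \<le> (2 ^ L) ^ H" using assms by (rule power_mono) simp
  also have "\<dots> = card ?B"
    using card_lists_length_eq[of "UNIV :: bool set" "H * L"]
    by (simp add: power_mult[symmetric] mult.commute)
  finally obtain e where e: "e ` ?J \<subseteq> ?B" "inj_on e ?J"
    using card_le_inj[OF fin] by blast
  \<comment> \<open>The padding gives every list the full length \<open>H * L\<close>, including the
    answer \<open>[]\<close> at a leaf, so messages keep their length after a leaf is
    reached.\<close>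
  define enc where "enc js = (if js \<in> ?J then e js else replicate (H * L) False)" for js
  have "length (enc js) = H * L" for js
    using e(1) by (auto simp: enc_def)
  moreover have "inj_on enc ?J \<longleftrightarrow> inj_on e ?J"
    by (rule inj_on_cong) (simp add: enc_def)
  ultimately show ?thesis using e(2) by blast
qed

theorem lemma1:
  fixes n H r :: nat and \<Sigma> :: "nat \<Rightarrow> 'a set" and f :: "(nat \<Rightarrow> 'a) \<Rightarrow> bool" and S :: "nat set"
  assumes "n \<ge> 1"
    and "\<forall>i\<in>{1..n}. finite (\<Sigma> i)"
    and "S \<subseteq> {1..n}"
    and "H \<ge> 1"
    and "r = rk H n \<Sigma> f"
    and "r \<ge> 1"
  shows "comm_Alice (r + 1) (alice_inputs \<Sigma> S) (bob_inputs n \<Sigma> S) (split_fun f S)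
           \<le> enat (2 * H * r * nat \<lceil>log 2 (real (card (assignments n \<Sigma>)))\<rceil>)
       \<and> comm_Bob (r + 1) (alice_inputs \<Sigma> S) (bob_inputs n \<Sigma> S) (split_fun f S)
           \<le> enat (2 * H * r * nat \<lceil>log 2 (real (card (assignments n \<Sigma>)))\<rceil>)"
proof -
  define N where "N = card (assignments n \<Sigma>)"
  define L where "L = nat \<lceil>log 2 (real N)\<rceil>"
  have N: "N \<ge> 2" unfolding N_def using card_assignments_ge_2 assms by blast
  have "log 2 (real N) > 0" using N by simp
  then have L: "L > 0" by (simp add: L_def)
  have "log 2 (real N) \<le> real L" unfolding L_def by linarith
  then have "real N \<le> 2 powr real L" using N by (subst (asm) log_le_iff) auto
  then have "real N \<le> real (2 ^ L)" by (simp add: powr_realpow)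
  then have "N \<le> 2 ^ L" by (simp only: of_nat_le_iff)
  from ex_encoding[OF this, of H] obtain enc :: "nat list \<Rightarrow> bool list"
    where len_enc: "\<And>js. length (enc js) = H * L"
    and inj: "inj_on enc {js. set js \<subseteq> {1..N} \<and> length js = H}"
    by blast
  define dec where "dec = inv_into {js. set js \<subseteq> {1..N} \<and> length js = H} enc"
  obtain t0 where t0: "query_tree H n \<Sigma> t0" "dtree_computes n \<Sigma> f t0" "dtree_depth t0 = r"
    using rk_attained[OF assms(2,4), of f] assms(5) by metis
  let ?ans = "\<lambda>T t x. enc (part_answer H n \<Sigma> T t x)"
  let ?nxt = "\<lambda>t u v. next_node H n \<Sigma> t (dec u) (dec v)"
  let ?res = "\<lambda>t :: (nat \<Rightarrow> 'a, (nat \<times> 'a) list, bool) dtree. case t of Leaf z \<Rightarrow> z"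
  \<comment> \<open>Restricted to inner nodes: at a leaf the answer \<open>[]\<close> lies outside
    the set on which \<open>enc\<close> is inverted, but \<open>next_node\<close> stays at a leaf
    whatever it receives.\<close>
  have dec_ans: "dec (?ans T (Node q ch) x) = part_answer H n \<Sigma> T (Node q ch) x"
    if "is_degree_query H n \<Sigma> q"
    for T q x and ch :: "_ \<Rightarrow> (nat \<Rightarrow> 'a, (nat \<times> 'a) list, bool) dtree option"
    unfolding dec_def
  proof (rule inv_into_f_f[OF inj])
    have "part_index n \<Sigma> T \<tau> x \<in> {1..N}" for \<tau>
      unfolding N_def by (rule part_index_props) (use N in \<open>simp add: N_def\<close>)
    then show "part_answer H n \<Sigma> T (Node q ch) x \<in> {js. set js \<subseteq> {1..N} \<and> length js = H}"
      using query_orderings(1)[OF that] by (auto simp: part_answer_def)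
  qed
  have run: "?res (((\<lambda>t. ?nxt t (?ans S t x) (?ans ({1..n} - S) t y)) ^^ r) t0) = split_fun f S x y"
    if x: "x \<in> alice_inputs \<Sigma> S" and y: "y \<in> bob_inputs n \<Sigma> S" for x y
  proof -
    define w where "w = (\<lambda>i. if i \<in> S then x i else y i)"
    have w: "w \<in> words n \<Sigma>"
      using x y assms(3)
      by (auto simp: w_def words_def alice_inputs_def bob_inputs_def PiE_def Pi_def extensional_def)
    have step: "?nxt t (?ans S t x) (?ans ({1..n} - S) t y) = tree_step w t"
      if t: "query_tree H n \<Sigma> t" for t :: "(nat \<Rightarrow> 'a, (nat \<times> 'a) list, bool) dtree"
      using t
    proof cases
      case (1 z)
      then show ?thesis by (simp add: next_node_def tree_step_def)
    next
      case (2 q ch)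
      then show ?thesis
        using next_node_eq_tree_step[OF assms(1,3) t w w_def] dec_ans by simp
    qed
    have "((\<lambda>t. ?nxt t (?ans S t x) (?ans ({1..n} - S) t y)) ^^ r) t0 = Leaf (dtree_output t0 w)"
      using step t0 by (intro tree_step_iterate[OF assms(2) w]) auto
    then show ?thesis
      using t0(2) w by (simp add: dtree_computes_def split_fun_def w_def)
  qed
  have HL: "H * L > 0" using L assms(4) by simp
  have "comm_Alice (r + 1) (alice_inputs \<Sigma> S) (bob_inputs n \<Sigma> S) (split_fun f S)
      \<le> enat (2 * (H * L) * r)"
    by (rule comm_Alice_le_of_answers[OF HL assms(6) len_enc len_enc,
          where nxt = ?nxt and res = ?res and ?s0.0 = t0]) (rule run)
  \<comment> \<open>The first speaker is now Bob, so his answer is the first one passed to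
    \<open>nxt\<close>; the swap hands both answers to \<open>next_node\<close> in the original
    order.\<close>
  moreover have "comm_Bob (r + 1) (alice_inputs \<Sigma> S) (bob_inputs n \<Sigma> S) (split_fun f S)
      \<le> enat (2 * (H * L) * r)"
    unfolding comm_Bob_def
    by (rule comm_Alice_le_of_answers[OF HL assms(6) len_enc len_enc,
          where nxt = "\<lambda>t v u. ?nxt t u v" and res = ?res and ?s0.0 = t0]) (rule run)
  ultimately show ?thesis
    by (simp add: L_def N_def mult.assoc mult.left_commute mult.commute)
qed

end
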